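(* Let $m,n\ge 1$ be integers, $\nu>0$, $\rho>0$, $\mathbf{\Sigma}\in\mathfrak{P}_n^\beta$ and let $\boldsymbol{\mu}\in\mathfrak{F}^{m\times n}$ be constant. Let $S\sim\mathbf{\Gamma}^\beta(\nu,\rho)$ be independent of $\mathbf{Y}\sim\mathcal{N}_{m\times n}^\beta(\mathbf{0},\mathbf{I}_m\otimes\mathbf{\Sigma})$, and define $\mathbf{T}_1=S^{-1/2}\mathbf{Y}+\boldsymbol{\mu}$, where $(S^{1/2})^2=S$. Then the density of $\mathbf{T}_1$ is $$\frac{\Gamma_1^\beta[\beta(\nu+mn)/2]\,\rho^{\beta mn/2}}{\pi^{\beta mn/2}\,\Gamma_1^\beta[\beta\nu/2]\,|\mathbf{\Sigma}|^{\beta m/2}}\Bigl[1+\rho\operatorname{tr}\mathbf{\Sigma}^{-1}(\mathbf{T}_1-\boldsymbol{\mu})^{*}(\mathbf{T}_1-\boldsymbol{\mu})\Bigr]^{-\beta(\nu+mn)/2},\qquad \mathbf{T}_1\in\mathfrak{F}^{m\times n}.$$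
   Context: Let $\beta\in\{1,2,4\}$ and let $\mathfrak{F}$ be the real numbers ($\beta=1$), the complex numbers ($\beta=2$) or the quaternions ($\beta=4$). $\mathfrak{F}^{m\times n}$ is the set of $m\times n$ matrices over $\mathfrak{F}$, and $\mathbf{A}^{*}$ is the conjugate transpose. $\mathfrak{P}_p^\beta$ is the cone of $p\times p$ positive definite Hermitian ($\mathbf{A}=\mathbf{A}^*$) matrices over $\mathfrak{F}$; for $\mathbf{A}\in\mathfrak{P}_p^\beta$, $|\mathbf{A}|$ is the product of its $p$ (positive real) eigenvalues. $\operatorname{tr}$ denotes the real part of the trace, and $\operatorname{etr}(\cdot)=\exp(\operatorname{tr}(\cdot))$. Densities on $\mathfrak{F}^{m\times n}$ are with respect to Lebesgue measure in the $\beta mn$ real components of the entries. $\Gamma_1^\beta[a]=\Gamma(a)$ is the ordinary gamma function. $S\sim\mathbf{\Gamma}^\beta(\nu,\rho)$ means that the positive real random variable $S$ has density $$\frac{1}{(2\beta^{-1})^{\beta\nu/2}\Gamma_1^\beta[\beta\nu/2]\rho^{\beta\nu/2}}\,s^{\beta\nu/2-1}\exp\{-\beta s/(2\rho)\},\quad s>0.$$ $\mathbf{Y}\sim\mathcal{N}_{m\times n}^\beta(\mathbf{0},\mathbf{I}_m\otimes\mathbf{\Sigma})$ means that $\mathbf{Y}\in\mathfrak{F}^{m\times n}$ has density $$\frac{1}{(2\pi\beta^{-1})^{\beta mn/2}|\mathbf{\Sigma}|^{\beta m/2}}\operatorname{etr}\{-\beta\mathbf{\Sigma}^{-1}\mathbf{Y}^{*}\mathbf{Y}/2\}.$$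 The distribution of $\mathbf{T}_1$ is called the matrix multivariate $T$ distribution. *)

theory Defs
  imports "HOL-Probability.Probability"
begin

section \<open>The quaternions\<close>

datatype quat = Quat (qRe: real) (qI: real) (qJ: real) (qK: real)

lemma quat_eq_iff: "x = y \<longleftrightarrow> qRe x = qRe y \<and> qI x = qI y \<and> qJ x = qJ y \<and> qK x = qK y"
  by (cases x; cases y) auto

instantiation quat :: ring_1
begin

definition "0 = Quat 0 0 0 0"
definition "1 = Quat 1 0 0 0"
definition "x + y = Quat (qRe x + qRe y) (qI x + qI y) (qJ x + qJ y) (qK x + qK y)"
definition "- x = Quat (- qRe x) (- qI x) (- qJ x) (- qK x)"
definition "x - y = Quat (qRe x - qRe y) (qI x - qI y) (qJ x - qJ y) (qK x - qK y)"
definition "x * y = Quat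
  (qRe x * qRe y - qI x * qI y - qJ x * qJ y - qK x * qK y)
  (qRe x * qI y + qI x * qRe y + qJ x * qK y - qK x * qJ y)
  (qRe x * qJ y - qI x * qK y + qJ x * qRe y + qK x * qI y)
  (qRe x * qK y + qI x * qJ y - qJ x * qI y + qK x * qRe y)"

instance
  by standard
    (simp_all add: zero_quat_def one_quat_def plus_quat_def uminus_quat_def minus_quat_def
      times_quat_def quat_eq_iff algebra_simps)

end

lemmas quat_arith_defs =
  zero_quat_def one_quat_def plus_quat_def uminus_quat_def minus_quat_def times_quat_def

instantiation quat :: real_algebra_1
begin

definition "scaleR r x = Quat (r * qRe x) (r * qI x) (r * qJ x) (r * qK x)"

instance
  by standard (simp_all add: quat_arith_defs scaleR_quat_def quat_eq_iff algebra_simps)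

end

instantiation quat :: euclidean_space
begin

definition "inner x y = qRe x * qRe y + qI x * qI y + qJ x * qJ y + qK x * qK y"
definition norm_quat_def: "norm x = sqrt (inner x (x :: quat))"
definition sgn_quat_def: "sgn x = x /\<^sub>R norm (x :: quat)"
definition dist_quat_def: "dist x y = norm (x - y :: quat)"
definition uniformity_quat_def:
  "(uniformity :: (quat \<times> quat) filter) = (INF e\<in>{0 <..}. principal {(x, y). dist x y < e})"
definition open_quat_def:
  "open (U :: quat set) \<longleftrightarrow> (\<forall>x\<in>U. eventually (\<lambda>(x', y). x' = x \<longrightarrow> y \<in> U) uniformity)"
definition Basis_quat_def:
  "Basis = {Quat 1 0 0 0, Quat 0 1 0 0, Quat 0 0 1 0, Quat 0 0 0 1}"

instance
proof
  fix x y z :: quat and r :: real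
  show "inner x y = inner y x"
    by (simp add: inner_quat_def algebra_simps)
  show "inner (x + y) z = inner x z + inner y z"
    by (simp add: inner_quat_def plus_quat_def algebra_simps)
  show "inner (scaleR r x) y = r * inner x y"
    by (simp add: inner_quat_def scaleR_quat_def algebra_simps)
  show "0 \<le> inner x x"
    by (simp add: inner_quat_def)
  show "inner x x = 0 \<longleftrightarrow> x = 0"
    by (auto simp: inner_quat_def zero_quat_def quat_eq_iff add_nonneg_eq_0_iff)
  show "(\<forall>u\<in>Basis. inner x u = 0) \<longleftrightarrow> x = 0"
    by (cases x) (simp add: Basis_quat_def inner_quat_def zero_quat_def)
qed (auto simp: norm_quat_def sgn_quat_def dist_quat_def uniformity_quat_def open_quat_def
      Basis_quat_def inner_quat_def)

end

lemma DIM_quat: "DIM(quat) = 4"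
  by (simp add: Basis_quat_def)

instantiation quat :: real_normed_div_algebra
begin

definition inverse_quat_def:
  "inverse x = Quat (qRe x) (- qI x) (- qJ x) (- qK x) /\<^sub>R inner x x"
definition divide_quat_def: "x div y = x * inverse (y :: quat)"

instance
proof
  fix x y :: quat
  have *: "inner x x * inverse (inner x x) = 1" if "x \<noteq> 0" for x :: quat
    using that by simp
  show "inverse x * x = 1" if "x \<noteq> 0"
    using *[OF that]
    by (simp add: quat_eq_iff inverse_quat_def times_quat_def one_quat_def scaleR_quat_def
        inner_quat_def algebra_simps)
  show "x * inverse x = 1" if "x \<noteq> 0"
    using *[OF that]
    by (simp add: quat_eq_iff inverse_quat_def times_quat_def one_quat_def scaleR_quat_def
        inner_quat_def algebra_simps)
  show "x div y = x * inverse y"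
    by (rule divide_quat_def)
  show "inverse (0 :: quat) = 0"
    by (simp add: inverse_quat_def zero_quat_def scaleR_quat_def inner_quat_def)
  have "inner (x * y) (x * y) = inner x x * inner y y"
    by (simp add: inner_quat_def times_quat_def algebra_simps)
  then show "norm (x * y) = norm x * norm y"
    by (simp add: norm_quat_def real_sqrt_mult)
qed

end


section \<open>The scalars: real numbers, complex numbers and quaternions\<close>

text \<open>
  By the Frobenius theorem the types of the following class are, up to isomorphism, exactly the
  real numbers, the complex numbers and the quaternions; all three are shown to be instances.
  The parameter beta is the real dimension \<open>DIM('a)\<close>. Since \<open>Basis\<close> is an orthonormal basis of the
  scalars, \<open>lborel\<close> on matrices over them is Lebesgue measure in the real components of the entries.
\<close>

class rch_scalar = real_normed_div_algebra + euclidean_space +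
  fixes hcnj :: "'a \<Rightarrow> 'a"
    and hRe :: "'a \<Rightarrow> real"
  assumes hcnj_add: "hcnj (x + y) = hcnj x + hcnj y"
    and hcnj_mult: "hcnj (x * y) = hcnj y * hcnj x"
    and mult_hcnj: "x * hcnj x = (norm x)\<^sup>2 *\<^sub>R 1"
    and add_hcnj: "x + hcnj x = (2 * hRe x) *\<^sub>R 1"
    and DIM_rch: "card Basis \<in> {1, 2, 4}"

instantiation real :: rch_scalar
begin

definition hcnj_real_def: "hcnj x = (x :: real)"
definition hRe_real_def: "hRe x = (x :: real)"

instance
  by standard (simp_all add: hcnj_real_def hRe_real_def power2_eq_square)

end

instantiation complex :: rch_scalar
begin

definition hcnj_complex_def: "hcnj z = cnj z"
definition hRe_complex_def: "hRe z = Re z"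

instance
  by standard
    (simp_all add: hcnj_complex_def hRe_complex_def complex_eq_iff cmod_power2
      power2_eq_square[symmetric])

end

instantiation quat :: rch_scalar
begin

definition hcnj_quat_def: "hcnj x = Quat (qRe x) (- qI x) (- qJ x) (- qK x)"
definition hRe_quat_def: "hRe x = qRe x"

instance
proof
  fix x y :: quat
  show "hcnj (x + y) = hcnj x + hcnj y"
    by (simp add: hcnj_quat_def plus_quat_def)
  show "hcnj (x * y) = hcnj y * hcnj x"
    by (simp add: hcnj_quat_def times_quat_def)
  show "x * hcnj x = (norm x)\<^sup>2 *\<^sub>R 1"
    by (simp add: hcnj_quat_def times_quat_def scaleR_quat_def one_quat_def
        norm_quat_def inner_quat_def power2_eq_square)
  show "x + hcnj x = (2 * hRe x) *\<^sub>R 1"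
    by (simp add: hcnj_quat_def hRe_quat_def plus_quat_def scaleR_quat_def one_quat_def)
  show "card (Basis :: quat set) \<in> {1, 2, 4}"
    by (simp add: DIM_quat)
qed

end


section \<open>Matrices\<close>

definition conj_transpose :: "'f::rch_scalar ^ 'n ^ 'm \<Rightarrow> 'f ^ 'm ^ 'n"
  where "conj_transpose A = (\<chi> i j. hcnj (A $ j $ i))"

definition pos_def :: "'f::rch_scalar ^ 'p ^ 'p \<Rightarrow> bool"
  where "pos_def A \<longleftrightarrow> conj_transpose A = A \<and>
    (\<forall>x. x \<noteq> 0 \<longrightarrow> 0 < hRe (\<Sum>i\<in>UNIV. hcnj (x $ i) * (A *v x) $ i))"

definition re_trace :: "'f::rch_scalar ^ 'p ^ 'p \<Rightarrow> real"
  where "re_trace A = hRe (trace A)"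

definition etr :: "'f::rch_scalar ^ 'p ^ 'p \<Rightarrow> real"
  where "etr A = exp (re_trace A)"

definition eigenspace :: "'f::rch_scalar ^ 'p ^ 'p \<Rightarrow> real \<Rightarrow> ('f ^ 'p) set"
  where "eigenspace A l = {x. A *v x = l *\<^sub>R x}"

text \<open>
  The product of the eigenvalues of a Hermitian matrix, counted with multiplicity. All eigenvalues
  of such a matrix are real and there are finitely many of them. The eigenspace is a right vector
  space over the scalars; its dimension over the scalars, which is the multiplicity of the
  eigenvalue, is its real dimension \<open>dim\<close> divided by \<open>DIM('f)\<close>.
\<close>

definition eigenvalue_prod :: "'f::rch_scalar ^ 'p ^ 'p \<Rightarrow> real"
  where "eigenvalue_prod A =
    (\<Prod>l | \<exists>x. x \<noteq> 0 \<and> x \<in> eigenspace A l. l ^ (dim (eigenspace A l) div DIM('f)))"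


section \<open>Distributions\<close>

text \<open>The density of the beta-gamma distribution; the parameters are beta, nu and rho.\<close>

definition beta_gamma_density :: "real \<Rightarrow> real \<Rightarrow> real \<Rightarrow> real \<Rightarrow> real"
  where "beta_gamma_density \<beta> \<nu> \<rho> s =
    (if 0 < s then
       1 / ((2 / \<beta>) powr (\<beta> * \<nu> / 2) * Gamma (\<beta> * \<nu> / 2) * \<rho> powr (\<beta> * \<nu> / 2))
         * s powr (\<beta> * \<nu> / 2 - 1) * exp (- \<beta> * s / (2 * \<rho>))
     else 0)"

text \<open>
  The density of the centred matrix normal distribution with row covariance the identity and column
  scale matrix \<open>\<Sigma>\<close>; an m-by-n matrix has type \<open>'f ^ 'n ^ 'm\<close>.
\<close>

definition matrix_normal_density ::
    "'f::rch_scalar ^ 'n ^ 'n \<Rightarrow> 'f ^ 'n ^ 'm \<Rightarrow> real"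
  where "matrix_normal_density \<Sigma> Y =
    (let \<beta> = real DIM('f); m = real CARD('m); n = real CARD('n) in
       1 / ((2 * pi / \<beta>) powr (\<beta> * m * n / 2) * eigenvalue_prod \<Sigma> powr (\<beta> * m / 2))
         * etr ((- \<beta> / 2) *\<^sub>R (matrix_inv \<Sigma> ** conj_transpose Y ** Y)))"

text \<open>
  The library's \<open>indep_var\<close> forces both random variables to have the same value type; this is its
  definition for two possibly different value types.
\<close>

definition indep_rvs ::
    "'w measure \<Rightarrow> 'a measure \<Rightarrow> ('w \<Rightarrow> 'a) \<Rightarrow> 'b measure \<Rightarrow> ('w \<Rightarrow> 'b) \<Rightarrow> bool"
  where "indep_rvs M A X B Y \<longleftrightarrow> X \<in> measurable M A \<and> Y \<in> measurable M B \<and>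
    prob_space.indep_set M
      (sigma_sets (space M) {X -` U \<inter> space M | U. U \<in> sets A})
      (sigma_sets (space M) {Y -` U \<inter> space M | U. U \<in> sets B})"

end

theory Submission
  imports Defs
begin

text \<open>
  Write \<open>Q Y\<close> for the real trace of \<open>matrix_inv \<Sigma> ** conj_transpose Y ** Y\<close> and \<open>d = \<beta> m n\<close> for the
  real dimension of the space of matrices. The matrix T distribution is a scale mixture of normal
  distributions: given \<open>S = s\<close>, the variable \<open>Y / sqrt s + \<mu>\<close> has at \<open>T\<close> the normal density
  evaluated at \<open>sqrt s * (T - \<mu>)\<close>, times the Jacobian \<open>s powr (d / 2)\<close>. Averaging over \<open>S\<close> gives
  the density of \<open>S powr (- 1 / 2) * Y + \<mu>\<close>
  (\<open>distributed_scale_mixture\<close>).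

  Since \<open>Q\<close> is homogeneous of degree two, the integrand of the mixture is, up to constants,
  \<open>s powr (\<beta> (\<nu> + m n) / 2 - 1) * exp (- (\<beta> / 2) (1 / \<rho> + Q (T - \<mu>)) s)\<close>, which is a gamma integral
  (\<open>beta_gamma_mixture_integral\<close>). Its value produces both the factor \<open>\<Gamma>(\<beta> (\<nu> + m n) / 2)\<close> and the
  power of \<open>1 + \<rho> Q (T - \<mu>)\<close>; the product of the eigenvalues of \<open>\<Sigma>\<close> is a constant factor throughout.

  The integral has this value because \<open>Q\<close> is nonnegative, which makes the exponential rate positive.
  This is where positive definiteness enters (\<open>re_trace_form_nonneg\<close>). As quaternions do not commute,
  the argument works not with determinants but with the real inner product of the scalars:
  \<open>hRe (hcnj x * y) = x \<bullet> y\<close>, so a matrix acts as a real-linear map on a Euclidean space, and the real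
  part of a trace is invariant under cyclic permutation.
\<close>

section \<open>The real inner product of the scalars\<close>

lemma hcnj_0 [simp]: "hcnj (0 :: 'f::rch_scalar) = 0"
  using hcnj_add[of "0 :: 'f" 0] by simp

lemma hcnj_of_real: "hcnj (r *\<^sub>R (1 :: 'f::rch_scalar)) = r *\<^sub>R 1"
proof (cases "r = 0")
  case False
  have "r *\<^sub>R hcnj (r *\<^sub>R (1 :: 'f)) = r\<^sup>2 *\<^sub>R 1"
    using mult_hcnj[of "r *\<^sub>R (1 :: 'f)"] by simp
  then have "r *\<^sub>R hcnj (r *\<^sub>R (1 :: 'f)) = r *\<^sub>R r *\<^sub>R 1"
    by (simp add: power2_eq_square)
  with False show ?thesis
    by (simp only: scaleR_cancel_left) simp
qed simp

lemma hcnj_scaleR: "hcnj (r *\<^sub>R (x :: 'f::rch_scalar)) = r *\<^sub>R hcnj x"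
  using hcnj_mult[of "r *\<^sub>R 1" x] by (simp add: hcnj_of_real)

lemma linear_hcnj: "linear (hcnj :: 'f::rch_scalar \<Rightarrow> 'f)"
  by (rule linearI) (simp_all add: hcnj_add hcnj_scaleR)

lemma hcnj_eq: "hcnj x = (2 * hRe x) *\<^sub>R 1 - (x :: 'f::rch_scalar)"
  using add_hcnj[of x] by (simp add: eq_diff_eq add.commute)

lemma hcnj_hcnj [simp]: "hcnj (hcnj x) = (x :: 'f::rch_scalar)"
  by (simp add: hcnj_eq[of x] linear_diff[OF linear_hcnj] hcnj_of_real)

lemma hcnj_mult_self: "hcnj x * x = (norm (x :: 'f::rch_scalar))\<^sup>2 *\<^sub>R 1"
  using mult_hcnj[of x] by (simp add: hcnj_eq algebra_simps)

lemma inner_eq_half_norms: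
  "(x :: 'f::rch_scalar) \<bullet> y = ((norm (x + y))\<^sup>2 - (norm x)\<^sup>2 - (norm y)\<^sup>2) / 2"
  by (simp add: power2_norm_eq_inner inner_add inner_commute)

text \<open>
  The norm determines the inner product, and \<open>x * hcnj x\<close> is the squared norm; polarising this
  identity yields the inner product.
\<close>

lemma hRe_mult_hcnj: "hRe (x * hcnj y) = (x :: 'f::rch_scalar) \<bullet> y"
proof -
  have "x * hcnj y + hcnj (x * hcnj y) = (x + y) * hcnj (x + y) - x * hcnj x - y * hcnj y"
    by (simp add: hcnj_add hcnj_mult algebra_simps)
  then have "(2 * hRe (x * hcnj y)) *\<^sub>R (1::'f) = (2 * (x \<bullet> y)) *\<^sub>R 1"
    by (simp add: add_hcnj mult_hcnj inner_eq_half_norms flip: scaleR_diff_left)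
  then show ?thesis
    by simp
qed

lemma hRe_hcnj_mult: "hRe (hcnj x * y) = (x :: 'f::rch_scalar) \<bullet> y"
proof -
  have "hcnj x * y + hcnj (hcnj x * y) = hcnj (x + y) * (x + y) - hcnj x * x - hcnj y * y"
    by (simp add: hcnj_add hcnj_mult algebra_simps)
  then have "(2 * hRe (hcnj x * y)) *\<^sub>R (1::'f) = (2 * (x \<bullet> y)) *\<^sub>R 1"
    by (simp add: add_hcnj hcnj_mult_self inner_eq_half_norms flip: scaleR_diff_left)
  then show ?thesis
    by simp
qed

lemma hRe_eq_inner: "hRe (x :: 'f::rch_scalar) = 1 \<bullet> x"
  using hRe_hcnj_mult[of 1 x] hcnj_of_real[where 'f='f, of 1] by simp

lemma linear_hRe: "linear (hRe :: 'f::rch_scalar \<Rightarrow> real)"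
  by (rule linearI) (simp_all add: hRe_eq_inner inner_add_right)

text \<open>The scalars need not commute, but their commutators have real part zero.\<close>

lemma hRe_mult_commute: "hRe (x * y) = hRe ((y :: 'f::rch_scalar) * x)"
  using hRe_mult_hcnj[of x "hcnj y"] hRe_hcnj_mult[of "hcnj y" x] by (simp add: inner_commute)


section \<open>The quadratic form in the exponent of the normal density\<close>

lemma re_trace_scaleR: "re_trace (c *\<^sub>R (A :: 'f::rch_scalar ^ 'p ^ 'p)) = c * re_trace A"
  by (simp add: re_trace_def trace_def linear_cmul[OF linear_hRe] flip: scaleR_sum_right)

lemma linear_matrix_vector_mult: "linear (\<lambda>x. (A :: 'f::rch_scalar ^ 'n ^ 'm) *v x)"
  by (rule linearI)
    (simp_all add: vec_eq_iff matrix_vector_mult_def scaleR_sum_right distrib_left sum.distrib)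

lemma pos_def_inner_pos:
  assumes "pos_def (A :: 'f::rch_scalar ^ 'p ^ 'p)" "x \<noteq> 0"
  shows "0 < x \<bullet> (A *v x)"
  using assms by (simp add: pos_def_def inner_vec_def linear_sum[OF linear_hRe] hRe_hcnj_mult)

text \<open>
  A positive definite matrix acts as an injective real-linear map, hence as a bijective one. This
  gives a right inverse column by column; by injectivity it is also a left inverse.
\<close>

lemma pos_def_matrix_inv:
  assumes "pos_def (A :: 'f::rch_scalar ^ 'p ^ 'p)"
  shows "A ** matrix_inv A = mat 1" "matrix_inv A ** A = mat 1"
proof -
  have inj: "x = 0" if "A *v x = 0" for x
    using pos_def_inner_pos[OF assms, of x] that by auto
  then have "inj (\<lambda>x. A *v x)"
    by (simp add: linear_injective_0[OF linear_matrix_vector_mult])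
  then have "surj (\<lambda>x. A *v x)"
    by (rule linear_inj_imp_surj[OF linear_matrix_vector_mult])
  then have "\<forall>j. \<exists>x. A *v x = axis j 1"
    by (metis surjD)
  then obtain w where w: "\<And>j. A *v w j = axis j 1"
    by metis
  define W :: "'f ^ 'p ^ 'p" where "W = (\<chi> i j. w j $ i)"
  have AW: "A ** W = mat 1"
  proof -
    have "(A ** W) $ i $ j = (A *v w j) $ i" for i j
      by (simp add: W_def matrix_matrix_mult_def matrix_vector_mult_def)
    then show ?thesis
      by (simp add: vec_eq_iff w mat_def axis_def)
  qed
  have "A *v ((W ** A) *v x - x) = 0" for x
    by (simp add: matrix_vector_mult_diff_distrib matrix_vector_mul_assoc matrix_mul_assoc AW)
  then have "(W ** A) *v x = mat 1 *v x" for x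
    using inj[of "(W ** A) *v x - x"] by simp
  then have "W ** A = mat 1"
    by (simp add: matrix_eq)
  with AW have "\<exists>A'. A ** A' = mat 1 \<and> A' ** A = mat 1"
    by blast
  then have "A ** matrix_inv A = mat 1 \<and> matrix_inv A ** A = mat 1"
    unfolding matrix_inv_def by (rule someI_ex)
  then show "A ** matrix_inv A = mat 1" "matrix_inv A ** A = mat 1"
    by auto
qed

lemma pos_def_inverse_inner_nonneg:
  assumes "pos_def (A :: 'f::rch_scalar ^ 'p ^ 'p)"
  shows "0 \<le> x \<bullet> (matrix_inv A *v x)"
proof -
  define w where "w = matrix_inv A *v x"
  have "A *v w = x"
    by (simp add: w_def matrix_vector_mul_assoc pos_def_matrix_inv[OF assms])
  moreover have "0 \<le> w \<bullet> (A *v w)"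
    using pos_def_inner_pos[OF assms, of w] by (cases "w = 0") auto
  ultimately show ?thesis
    by (simp add: w_def inner_commute)
qed

text \<open>
  Expanding the trace along the rows of \<open>Y\<close> and moving a factor around cyclically under the real
  part exhibits it as a sum of quadratic forms, one for each conjugated row.
\<close>

lemma re_trace_eq_row_forms:
  fixes B :: "'f::rch_scalar ^ 'n ^ 'n" and Y :: "'f ^ 'n ^ 'm"
  shows "re_trace (B ** conj_transpose Y ** Y) =
    (\<Sum>k\<in>UNIV. (\<chi> j. hcnj (Y $ k $ j)) \<bullet> (B *v (\<chi> j. hcnj (Y $ k $ j))))"
proof -
  have term_eq: "hRe (B $ i $ j * hcnj (Y $ k $ j) * Y $ k $ i) =
      hcnj (Y $ k $ i) \<bullet> (B $ i $ j * hcnj (Y $ k $ j))" for i j k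
    by (simp add: hRe_mult_commute[of _ "Y $ k $ i"] flip: hRe_hcnj_mult)
  have "re_trace (B ** conj_transpose Y ** Y) =
      (\<Sum>i\<in>UNIV. \<Sum>k\<in>UNIV. \<Sum>j\<in>UNIV. hRe (B $ i $ j * hcnj (Y $ k $ j) * Y $ k $ i))"
    by (simp add: re_trace_def trace_def matrix_matrix_mult_def conj_transpose_def
        sum_distrib_right linear_sum[OF linear_hRe])
  also have "\<dots> = (\<Sum>k\<in>UNIV. \<Sum>i\<in>UNIV. \<Sum>j\<in>UNIV. hRe (B $ i $ j * hcnj (Y $ k $ j) * Y $ k $ i))"
    by (rule sum.swap)
  finally show ?thesis
    by (simp add: term_eq inner_vec_def matrix_vector_mult_def inner_sum_right)
qed

lemma re_trace_form_scaleR: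
  fixes B :: "'f::rch_scalar ^ 'n ^ 'n" and Y :: "'f ^ 'n ^ 'm"
  shows "re_trace (B ** conj_transpose (c *\<^sub>R Y) ** (c *\<^sub>R Y)) =
    c\<^sup>2 * re_trace (B ** conj_transpose Y ** Y)"
proof -
  have row: "(\<chi> j. hcnj ((c *\<^sub>R Y) $ k $ j)) = c *\<^sub>R (\<chi> j. hcnj (Y $ k $ j))" for k
    by (simp add: vec_eq_iff hcnj_scaleR)
  show ?thesis
    by (simp only: re_trace_eq_row_forms row linear_cmul[OF linear_matrix_vector_mult]
        inner_scaleR_left inner_scaleR_right sum_distrib_left power2_eq_square mult.assoc)
qed

lemma re_trace_form_nonneg:
  assumes "pos_def (\<Sigma> :: 'f::rch_scalar ^ 'n ^ 'n)"
  shows "0 \<le> re_trace (matrix_inv \<Sigma> ** conj_transpose Y ** (Y :: 'f ^ 'n ^ 'm))"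
  unfolding re_trace_eq_row_forms by (intro sum_nonneg pos_def_inverse_inner_nonneg[OF assms])


section \<open>Random rescaling of a random vector\<close>

lemma (in prob_space) distr_pair_indep_rvs:
  assumes "indep_rvs M A X B Y"
  shows "distr M A X \<Otimes>\<^sub>M distr M B Y = distr M (A \<Otimes>\<^sub>M B) (\<lambda>\<omega>. (X \<omega>, Y \<omega>))"
proof (rule pair_measure_eqI)
  have X [measurable]: "X \<in> measurable M A" and Y [measurable]: "Y \<in> measurable M B"
    and indep: "indep_set (sigma_sets (space M) {X -` U \<inter> space M | U. U \<in> sets A})
      (sigma_sets (space M) {Y -` U \<inter> space M | U. U \<in> sets B})"
    using assms by (auto simp: indep_rvs_def)
  interpret X: prob_space "distr M A X"
    by (rule prob_space_distr) fact
  interpret Y: prob_space "distr M B Y"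
    by (rule prob_space_distr) fact
  show "sigma_finite_measure (distr M A X)" "sigma_finite_measure (distr M B Y)"
    by unfold_locales
  show "sets (distr M A X \<Otimes>\<^sub>M distr M B Y) = sets (distr M (A \<Otimes>\<^sub>M B) (\<lambda>\<omega>. (X \<omega>, Y \<omega>)))"
    by (simp cong: sets_pair_measure_cong)
  fix U V assume "U \<in> sets (distr M A X)" "V \<in> sets (distr M B Y)"
  then have [measurable]: "U \<in> sets A" "V \<in> sets B"
    by auto
  have "prob ((X -` U \<inter> space M) \<inter> (Y -` V \<inter> space M)) =
      prob (X -` U \<inter> space M) * prob (Y -` V \<inter> space M)"
    by (rule indep_setD[OF indep]; rule sigma_sets.Basic; auto)
  moreover have "(\<lambda>\<omega>. (X \<omega>, Y \<omega>)) -` (U \<times> V) \<inter> space M =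
      (X -` U \<inter> space M) \<inter> (Y -` V \<inter> space M)"
    by auto
  ultimately show "emeasure (distr M A X) U * emeasure (distr M B Y) V =
      emeasure (distr M (A \<Otimes>\<^sub>M B) (\<lambda>\<omega>. (X \<omega>, Y \<omega>))) (U \<times> V)"
    by (simp add: emeasure_distr emeasure_eq_measure ennreal_mult)
qed

lemma nn_integral_lborel_affine:
  fixes h :: "'e::euclidean_space \<Rightarrow> ennreal"
  assumes [measurable]: "h \<in> borel_measurable borel" and c: "c \<noteq> 0"
  shows "(\<integral>\<^sup>+y. h y \<partial>lborel) = (\<integral>\<^sup>+x. ennreal (\<bar>c\<bar> ^ DIM('e)) * h (t + c *\<^sub>R x) \<partial>lborel)"
  by (subst lborel_affine[OF c, of t])
    (simp add: nn_integral_density nn_integral_distr nn_integral_cmult)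

text \<open>
  Conditionally on \<open>S = s\<close>, the vector \<open>Y / sqrt s + \<mu>\<close> has density
  \<open>sqrt s ^ d * g (sqrt s * (t - \<mu>))\<close> with \<open>d\<close> the real dimension; the unconditional density is the
  mixture over the law of \<open>S\<close>.
\<close>

lemma (in prob_space) distributed_scale_mixture:
  fixes Y :: "'a \<Rightarrow> 'e::euclidean_space" and \<mu> :: 'e
  assumes S: "distributed M lborel S f" and Y: "distributed M lborel Y g"
    and indep: "indep_rvs M borel S borel Y"
    and f_zero: "\<And>s. s \<le> 0 \<Longrightarrow> f s = 0"
  shows "distributed M lborel (\<lambda>\<omega>. (1 / sqrt (S \<omega>)) *\<^sub>R Y \<omega> + \<mu>)
    (\<lambda>t. \<integral>\<^sup>+s. f s * (ennreal (sqrt s ^ DIM('e)) * g (sqrt s *\<^sub>R (t - \<mu>))) \<partial>lborel)"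
    (is "distributed M lborel ?T ?p")
proof -
  have [measurable]: "f \<in> borel_measurable borel" "g \<in> borel_measurable borel"
    using distributed_borel_measurable[OF S] distributed_borel_measurable[OF Y] by simp_all
  have [measurable]: "S \<in> borel_measurable M" "Y \<in> borel_measurable M"
    using distributed_measurable[OF S] distributed_measurable[OF Y] by simp_all
  have [measurable]: "?p \<in> borel_measurable borel"
    by measurable
  interpret Y: prob_space "distr M borel Y"
    by (rule prob_space_distr) measurable
  have law_S: "distr M borel S = density lborel f"
    using distributed_distr_eq_density[OF S] by (simp cong: distr_cong)
  have law_Y: "distr M borel Y = density lborel g"
    using distributed_distr_eq_density[OF Y] by (simp cong: distr_cong)
  have "distr M lborel ?T = density lborel ?p"
  proof (rule measure_eqI)
    fix A :: "'e set" assume "A \<in> sets (distr M lborel ?T)"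
    then have [measurable]: "A \<in> sets borel"
      by simp
    define G :: "real \<times> 'e \<Rightarrow> ennreal"
      where "G = (\<lambda>(s, y). indicator A ((1 / sqrt s) *\<^sub>R y + \<mu>))"
    have G [measurable]: "G \<in> borel_measurable (borel \<Otimes>\<^sub>M borel)"
      unfolding G_def by measurable
    have inner: "f s * (\<integral>\<^sup>+y. g y * G (s, y) \<partial>lborel) =
        (\<integral>\<^sup>+t. f s * (ennreal (sqrt s ^ DIM('e)) * g (sqrt s *\<^sub>R (t - \<mu>))) * indicator A t \<partial>lborel)"
      for s
    proof (cases "0 < s")
      case True
      \<comment> \<open>the substitution \<open>y = sqrt s * (t - \<mu>)\<close>\<close>
      have "(\<integral>\<^sup>+y. g y * G (s, y) \<partial>lborel) =
          (\<integral>\<^sup>+t. ennreal (\<bar>sqrt s\<bar> ^ DIM('e)) *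
            (g (- (sqrt s *\<^sub>R \<mu>) + sqrt s *\<^sub>R t) * G (s, - (sqrt s *\<^sub>R \<mu>) + sqrt s *\<^sub>R t)) \<partial>lborel)"
        using True by (intro nn_integral_lborel_affine) (auto simp: G_def)
      also have "\<dots> = (\<integral>\<^sup>+t. ennreal (sqrt s ^ DIM('e)) * g (sqrt s *\<^sub>R (t - \<mu>)) * indicator A t \<partial>lborel)"
        using True by (intro nn_integral_cong)
          (simp add: G_def scaleR_diff_right scaleR_add_right mult.assoc)
      finally show ?thesis
        by (simp add: nn_integral_cmult[symmetric] mult.assoc)
    qed (simp add: f_zero)
    have "emeasure (distr M lborel ?T) A = (\<integral>\<^sup>+z. G z \<partial>distr M (borel \<Otimes>\<^sub>M borel) (\<lambda>\<omega>. (S \<omega>, Y \<omega>)))"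
      by (simp add: nn_integral_distr G_def flip: nn_integral_indicator)
    also have "\<dots> = (\<integral>\<^sup>+z. G z \<partial>(distr M borel S \<Otimes>\<^sub>M distr M borel Y))"
      by (simp add: distr_pair_indep_rvs[OF indep])
    also have "\<dots> = (\<integral>\<^sup>+s. \<integral>\<^sup>+y. G (s, y) \<partial>distr M borel Y \<partial>distr M borel S)"
      by (rule Y.nn_integral_fst[symmetric]) simp
    also have "\<dots> = (\<integral>\<^sup>+s. f s * (\<integral>\<^sup>+y. g y * G (s, y) \<partial>lborel) \<partial>lborel)"
      unfolding law_S law_Y by (simp add: nn_integral_density)
    also have "\<dots> = (\<integral>\<^sup>+s. \<integral>\<^sup>+t. f s * (ennreal (sqrt s ^ DIM('e)) * g (sqrt s *\<^sub>R (t - \<mu>)))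
        * indicator A t \<partial>lborel \<partial>lborel)"
      by (simp only: inner)
    also have "\<dots> = (\<integral>\<^sup>+t. \<integral>\<^sup>+s. f s * (ennreal (sqrt s ^ DIM('e)) * g (sqrt s *\<^sub>R (t - \<mu>)))
        * indicator A t \<partial>lborel \<partial>lborel)"
      by (rule lborel_pair.Fubini') measurable
    also have "\<dots> = emeasure (density lborel ?p) A"
      by (simp add: emeasure_density nn_integral_multc)
    finally show "emeasure (distr M lborel ?T) A = emeasure (density lborel ?p) A" .
  qed simp
  then show ?thesis
    unfolding distributed_def by simp
qed


section \<open>The mixing integral\<close>

lemma nn_integral_gamma_kernel:
  assumes a: "0 < a" and b: "0 < (b :: real)"
  shows "(\<integral>\<^sup>+s. ennreal (if 0 < s then s powr (a - 1) * exp (- b * s) else 0) \<partial>lborel) =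
    ennreal (Gamma a / b powr a)"
proof -
  let ?k = "\<lambda>t::real. ennreal (indicator {0..} t * t powr (a - 1) / exp t)"
  have "ennreal (Gamma a) = (\<integral>\<^sup>+t. ?k t \<partial>lborel)"
    by (rule Gamma_conv_nn_integral_real[OF a])
  also have "\<dots> = ennreal \<bar>b\<bar> * (\<integral>\<^sup>+s. ?k (0 + b * s) \<partial>lborel)"
    using b by (intro nn_integral_real_affine) auto
  also have "\<dots> = (\<integral>\<^sup>+s. ennreal \<bar>b\<bar> * ?k (0 + b * s) \<partial>lborel)"
    by (rule nn_integral_cmult[symmetric]) measurable
  also have "\<dots> = (\<integral>\<^sup>+s. ennreal (b powr a) *
      ennreal (if 0 < s then s powr (a - 1) * exp (- b * s) else 0) \<partial>lborel)"
  proof (intro nn_integral_cong)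
    fix s :: real
    have "b * (b * s) powr (a - 1) = b powr a * s powr (a - 1)" if "0 < s"
      using that b by (simp add: powr_mult powr_diff)
    then show "ennreal \<bar>b\<bar> * ?k (0 + b * s) = ennreal (b powr a) *
        ennreal (if 0 < s then s powr (a - 1) * exp (- b * s) else 0)"
      using b by (auto simp: indicator_def zero_le_mult_iff exp_minus field_simps
          simp flip: ennreal_mult' ennreal_mult)
  qed
  also have "\<dots> = ennreal (b powr a) *
      (\<integral>\<^sup>+s. ennreal (if 0 < s then s powr (a - 1) * exp (- b * s) else 0) \<partial>lborel)"
    by (rule nn_integral_cmult) measurable
  finally have "ennreal (Gamma a) / ennreal (b powr a) =
      (\<integral>\<^sup>+s. ennreal (if 0 < s then s powr (a - 1) * exp (- b * s) else 0) \<partial>lborel)"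
    using b by (simp add: mult.commute[of "ennreal (b powr a)"] ennreal_mult_divide_eq)
  then show ?thesis
    using a b by (simp add: divide_ennreal)
qed

text \<open>
  Both densities are powers times exponentials in the mixing variable, so the mixture is a single
  gamma integral with shape \<open>\<beta> * \<nu> / 2 + d / 2\<close> and rate \<open>\<beta> / 2 * (1 / \<rho> + Q)\<close>. Here \<open>d\<close> is the
  dimension, \<open>Q\<close> the value of the quadratic form, and \<open>D\<close> the determinantal factor, which passes
  through unchanged.
\<close>

lemma beta_gamma_mixture_integral:
  fixes \<beta> \<nu> \<rho> Q D :: real and d :: nat
  assumes \<beta>: "0 < \<beta>" and \<nu>: "0 < \<nu>" and \<rho>: "0 < \<rho>" and Q: "0 \<le> Q" and D: "0 \<le> D"
  shows "(\<integral>\<^sup>+s. ennreal (beta_gamma_density \<beta> \<nu> \<rho> s) * (ennreal (sqrt s ^ d) *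
      ennreal (1 / ((2 * pi / \<beta>) powr (d / 2) * D) * exp (- \<beta> / 2 * ((sqrt s)\<^sup>2 * Q)))) \<partial>lborel) =
    ennreal (Gamma (\<beta> * \<nu> / 2 + d / 2) * \<rho> powr (d / 2) /
      (pi powr (d / 2) * Gamma (\<beta> * \<nu> / 2) * D) * (1 + \<rho> * Q) powr (- (\<beta> * \<nu> / 2 + d / 2)))"
proof -
  define k a b where "k = \<beta> * \<nu> / 2" and "a = k + d / 2" and "b = \<beta> / 2 * (1 / \<rho> + Q)"
  define C where "C = 1 / ((2 / \<beta>) powr k * Gamma k * \<rho> powr k) *
    (1 / ((2 * pi / \<beta>) powr (d / 2) * D))"
  have k: "0 < k" and a: "0 < a" and b: "0 < b"
    using \<beta> \<nu> \<rho> Q by (auto simp: k_def a_def b_def intro!: mult_pos_pos add_pos_nonneg)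
  have C: "0 \<le> C"
    using D k by (auto simp: C_def intro!: mult_nonneg_nonneg divide_nonneg_nonneg Gamma_real_nonneg)
  have "ennreal (beta_gamma_density \<beta> \<nu> \<rho> s) * (ennreal (sqrt s ^ d) *
      ennreal (1 / ((2 * pi / \<beta>) powr (d / 2) * D) * exp (- \<beta> / 2 * ((sqrt s)\<^sup>2 * Q)))) =
      ennreal C * ennreal (if 0 < s then s powr (a - 1) * exp (- b * s) else 0)" for s
  proof (cases "0 < s")
    case True
    have "s powr (k - 1) * sqrt s ^ d = s powr (a - 1)"
      using True by (simp add: a_def powr_half_sqrt[symmetric] powr_power diff_add_eq flip: powr_add)
    moreover have "exp (- \<beta> * s / (2 * \<rho>)) * exp (- \<beta> / 2 * ((sqrt s)\<^sup>2 * Q)) = exp (- b * s)"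
      using True \<rho> by (simp add: b_def field_simps flip: exp_add)
    ultimately have "beta_gamma_density \<beta> \<nu> \<rho> s * (sqrt s ^ d *
        (1 / ((2 * pi / \<beta>) powr (d / 2) * D) * exp (- \<beta> / 2 * ((sqrt s)\<^sup>2 * Q)))) =
        C * (s powr (a - 1) * exp (- b * s))"
      using True by (simp add: beta_gamma_density_def C_def flip: k_def)
        (metis (no_types, lifting) mult.assoc mult.left_commute mult.commute)
    moreover have "0 \<le> sqrt s ^ d"
      using True by simp
    moreover have "0 \<le> beta_gamma_density \<beta> \<nu> \<rho> s"
      using k by (auto simp: beta_gamma_density_def Gamma_real_nonneg simp flip: k_def)
    ultimately show ?thesis
      using True C by (simp only: if_True flip: ennreal_mult')
  qed (simp add: beta_gamma_density_def)
  then have "(\<integral>\<^sup>+s. ennreal (beta_gamma_density \<beta> \<nu> \<rho> s) * (ennreal (sqrt s ^ d) *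
      ennreal (1 / ((2 * pi / \<beta>) powr (d / 2) * D) * exp (- \<beta> / 2 * ((sqrt s)\<^sup>2 * Q)))) \<partial>lborel) =
      ennreal C * ennreal (Gamma a / b powr a)"
    by (simp add: nn_integral_cmult nn_integral_gamma_kernel[OF a b])
  also have "\<dots> = ennreal (C * (Gamma a / b powr a))"
    using C by (simp only: ennreal_mult')
  also have "C * (Gamma a / b powr a) = Gamma a * \<rho> powr (d / 2) /
      (pi powr (d / 2) * Gamma k * D) * (1 + \<rho> * Q) powr (- a)"
  proof -
    have "b = (1 + \<rho> * Q) / (2 / \<beta> * \<rho>)"
      using \<beta> \<rho> by (simp add: b_def field_simps)
    then have "b powr a = (1 + \<rho> * Q) powr a / (2 / \<beta> * \<rho>) powr a"
      using \<beta> \<rho> Q by (simp only: powr_divide)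
    also have "(2 / \<beta> * \<rho>) powr a =
        (2 / \<beta>) powr k * (2 / \<beta>) powr (d / 2) * (\<rho> powr k * \<rho> powr (d / 2))"
      using \<beta> \<rho> by (simp only: powr_mult a_def powr_add mult_ac)
    finally have b_powr: "b powr a = (1 + \<rho> * Q) powr a /
        ((2 / \<beta>) powr k * (2 / \<beta>) powr (d / 2) * (\<rho> powr k * \<rho> powr (d / 2)))" .
    have pi_powr: "(2 * pi / \<beta>) powr (d / 2) = (2 / \<beta>) powr (d / 2) * pi powr (d / 2)"
      using \<beta> by (simp flip: powr_mult)
    have "(2 / \<beta>) powr k \<noteq> 0" "(2 / \<beta>) powr (d / 2) \<noteq> 0" "\<rho> powr k \<noteq> 0"
      using \<beta> \<rho> by auto
    then show ?thesis
      unfolding C_def b_powr pi_powr powr_minus by (simp add: divide_simps)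
  qed
  finally show ?thesis
    by (simp only: k_def a_def)
qed


section \<open>The matrix multivariate T distribution\<close>

theorem theorem3p1:
  fixes M :: "'w measure"
    and S :: "'w \<Rightarrow> real"
    and Y :: "'w \<Rightarrow> 'f::rch_scalar ^ 'n ^ 'm"
    and \<Sigma> :: "'f ^ 'n ^ 'n"
    and \<mu> :: "'f ^ 'n ^ 'm"
    and \<beta> \<nu> \<rho> m n :: real
  assumes "\<beta> = real DIM('f)" and "m = real CARD('m)" and "n = real CARD('n)"
    and "0 < \<nu>" and "0 < \<rho>" and "pos_def \<Sigma>"
    and "prob_space M"
    and "distributed M lborel S (\<lambda>s. ennreal (beta_gamma_density \<beta> \<nu> \<rho> s))"
    and "distributed M lborel Y (\<lambda>y. ennreal (matrix_normal_density \<Sigma> y))"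
    and "indep_rvs M borel S borel Y"
  shows "distributed M lborel (\<lambda>\<omega>. (1 / sqrt (S \<omega>)) *\<^sub>R Y \<omega> + \<mu>)
    (\<lambda>T. ennreal
      (Gamma (\<beta> * (\<nu> + m * n) / 2) * \<rho> powr (\<beta> * m * n / 2)
        / (pi powr (\<beta> * m * n / 2) * Gamma (\<beta> * \<nu> / 2) * eigenvalue_prod \<Sigma> powr (\<beta> * m / 2))
        * (1 + \<rho> * re_trace (matrix_inv \<Sigma> ** conj_transpose (T - \<mu>) ** (T - \<mu>)))
            powr (- \<beta> * (\<nu> + m * n) / 2)))"
proof -
  interpret prob_space M
    by fact
  define d where "d = DIM('f ^ 'n ^ 'm)"
  define D where "D = eigenvalue_prod \<Sigma> powr (\<beta> * m / 2)"
  define Q where "Q y = re_trace (matrix_inv \<Sigma> ** conj_transpose y ** y)" for y :: "'f ^ 'n ^ 'm"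
  have d: "\<beta> * m * n / 2 = d / 2"
    by (simp add: d_def assms(1-3))
  have \<beta>: "0 < \<beta>"
    by (simp add: assms(1))
  have normal: "matrix_normal_density \<Sigma> (c *\<^sub>R y) =
      1 / ((2 * pi / \<beta>) powr (d / 2) * D) * exp (- \<beta> / 2 * (c\<^sup>2 * Q y))"
    for c and y :: "'f ^ 'n ^ 'm"
    unfolding matrix_normal_density_def Let_def assms(1-3)[symmetric] d D_def[symmetric]
    by (simp only: etr_def re_trace_scaleR re_trace_form_scaleR Q_def)
  \<comment> \<open>nonnegativity of \<open>Q\<close> is what makes the mixing integral converge\<close>
  have mixture: "(\<integral>\<^sup>+s. ennreal (beta_gamma_density \<beta> \<nu> \<rho> s) * (ennreal (sqrt s ^ d) *
      ennreal (matrix_normal_density \<Sigma> (sqrt s *\<^sub>R (T - \<mu>)))) \<partial>lborel) =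
    ennreal (Gamma (\<beta> * \<nu> / 2 + d / 2) * \<rho> powr (d / 2) /
      (pi powr (d / 2) * Gamma (\<beta> * \<nu> / 2) * D) * (1 + \<rho> * Q (T - \<mu>)) powr (- (\<beta> * \<nu> / 2 + d / 2)))"
    for T
    unfolding normal
    by (intro beta_gamma_mixture_integral \<beta> \<open>0 < \<nu>\<close> \<open>0 < \<rho>\<close>)
      (simp_all add: Q_def D_def re_trace_form_nonneg[OF \<open>pos_def \<Sigma>\<close>])
  have shape: "\<beta> * \<nu> / 2 + d / 2 = \<beta> * (\<nu> + m * n) / 2"
    "- (\<beta> * \<nu> / 2 + d / 2) = - \<beta> * (\<nu> + m * n) / 2"
    using d by (simp_all add: field_simps)
  have "distributed M lborel (\<lambda>\<omega>. (1 / sqrt (S \<omega>)) *\<^sub>R Y \<omega> + \<mu>)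
      (\<lambda>T. \<integral>\<^sup>+s. ennreal (beta_gamma_density \<beta> \<nu> \<rho> s) * (ennreal (sqrt s ^ d) *
        ennreal (matrix_normal_density \<Sigma> (sqrt s *\<^sub>R (T - \<mu>)))) \<partial>lborel)"
    unfolding d_def
    by (rule distributed_scale_mixture[OF assms(8-10)]) (simp add: beta_gamma_density_def)
  then show ?thesis
    unfolding mixture shape d D_def Q_def by simp
qed

end
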